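(* Let $K$ be a field of characteristic zero and let $L$ be a finite dimensional Lie algebra over $K$. Suppose there exist an abelian Lie subalgebra $A \leq L$ and an integer $n > 1$ such that $L^n \subseteq [A, L]$. Then $L$ is solvable.
   Context: $L^n$ denotes the $n$-th term of the lower central series of $L$, indexed by $L^1 = L$ and $L^{k+1} = [L, L^k]$ (so $L^2 = [L,L]$). $[A, L]$ denotes the $K$-linear span of all brackets $[a, u]$ with $a \in A$, $u \in L$. *)

theory Defs
  imports Complex_Main
begin

locale lie_algebra = vector_space scale
  for scale :: "'k::field \<Rightarrow> 'v::ab_group_add \<Rightarrow> 'v" +
  fixes bracket :: "'v \<Rightarrow> 'v \<Rightarrow> 'v" (\<open>\<lblot>_,/ _\<rblot>\<close>)
  assumes bracket_linear_left: "Vector_Spaces.linear scale scale (\<lambda>x. \<lblot>x, y\<rblot>)"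
    and bracket_linear_right: "Vector_Spaces.linear scale scale (\<lambda>y. \<lblot>x, y\<rblot>)"
    and bracket_self: "\<lblot>x, x\<rblot> = 0"
    and jacobi: "\<lblot>x, \<lblot>y, z\<rblot>\<rblot> + \<lblot>y, \<lblot>z, x\<rblot>\<rblot> + \<lblot>z, \<lblot>x, y\<rblot>\<rblot> = 0"
begin

definition bracket_span :: "'v set \<Rightarrow> 'v set \<Rightarrow> 'v set" where
  "bracket_span A B = span {\<lblot>a, b\<rblot> | a b. a \<in> A \<and> b \<in> B}"

definition lie_subalgebra :: "'v set \<Rightarrow> bool" where
  "lie_subalgebra A \<longleftrightarrow> subspace A \<and> (\<forall>x\<in>A. \<forall>y\<in>A. \<lblot>x, y\<rblot> \<in> A)"

definition abelian :: "'v set \<Rightarrow> bool" where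
  "abelian A \<longleftrightarrow> (\<forall>x\<in>A. \<forall>y\<in>A. \<lblot>x, y\<rblot> = 0)"

text \<open>
  In the following notions the argument \<open>L\<close> is a Lie subalgebra, regarded as a Lie algebra
  in its own right; the whole Lie algebra is \<open>UNIV\<close>. The lower central series starts at index 1;
  the value at index 0 is a convention.
\<close>

fun lower_central :: "'v set \<Rightarrow> nat \<Rightarrow> 'v set" where
  "lower_central L 0 = L"
| "lower_central L (Suc 0) = L"
| "lower_central L (Suc (Suc k)) = bracket_span L (lower_central L (Suc k))"

primrec derived_series :: "'v set \<Rightarrow> nat \<Rightarrow> 'v set" where
  "derived_series L 0 = L"
| "derived_series L (Suc k) = bracket_span (derived_series L k) (derived_series L k)"

definition solvable :: "'v set \<Rightarrow> bool" where
  "solvable L \<longleftrightarrow> (\<exists>k. derived_series L k = {0})"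

end

end

theory Submission
  imports Defs "HOL-Algebra.Algebraic_Closure_Type" "HOL-Library.Function_Algebras"
begin

text \<open>
  Every \<open>x \<in> L\<^sup>n\<close> is ad-nilpotent, so \<open>L\<^sup>n\<close> is solvable by Engel's theorem, and so is \<open>L\<close>.
  For the nilpotency put \<open>D = ad x\<close> and let \<open>f\<close> be an additive map from the algebraic closure of \<open>K\<close>
  to the rationals. The map acting as \<open>f \<lambda>\<close> on the generalized \<open>\<lambda>\<close>-eigenspace of \<open>D\<close> is a
  derivation of the scalar extension; composing it with a \<open>K\<close>-linear functional on the closure gives a
  derivation \<open>E\<close> of \<open>L\<close> itself, whose range lies in that of every power of \<open>D\<close>, hence in
  \<open>L\<^sup>n \<subseteq> [A, L]\<close>. If \<open>D\<close> is not nilpotent, \<open>f\<close> and the functional can be chosen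
  such that \<open>tr (D E) \<noteq> 0\<close>, because \<open>f (\<Sum> f \<lambda> \<cdot> \<lambda>) = \<Sum> (f \<lambda>)\<^sup>2\<close>.
  On the other hand \<open>tr (ad [a, c] E) = - tr (ad a ad (E c))\<close> for \<open>a \<in> A\<close>, which vanishes since
  \<open>E c \<in> [A, L]\<close> and \<open>A\<close> is abelian; by linearity \<open>tr (D E) = 0\<close>.
\<close>

section \<open>Generalized eigenspaces over an algebraically closed field\<close>

lemma (in vector_space) linear_funpow:
  assumes "Vector_Spaces.linear scale scale T"
  shows "Vector_Spaces.linear scale scale (T ^^ k)"
  using assms by (induction k) (auto simp: Vector_Spaces.linear_iff)

locale alg_closed_vector_space = vector_space scale
  for scale :: "'a::alg_closed_field \<Rightarrow> 'b::ab_group_add \<Rightarrow> 'b"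
begin

text \<open>The \<open>card S + 1\<close> vectors u, T u, T^2 u, ... lie in a space spanned by
  \<open>card S\<close> vectors, so some nonzero polynomial in T kills u, and 0 lies in
  \<open>Y\<close>.\<close>

lemma poly_annihilates_modulo:
  assumes T: "Vector_Spaces.linear scale scale T"
    and Y: "subspace Y" and U: "U \<subseteq> span S" "finite S" and TU: "T ` U \<subseteq> U"
    and u: "u \<in> U"
  shows "\<exists>p. p \<noteq> 0 \<and> (\<Sum>k\<le>degree p. scale (coeff p k) ((T ^^ k) u)) \<in> Y"
proof -
  have Tk: "(T ^^ k) u \<in> U" for k
    using u TU by (induction k) auto
  show ?thesis
  \<comment> \<open>\<open>dependent\<close> speaks of sets, so a repetition among the iterates
    would get lost in their image. A repetition T^i u = T^j u gives the polynomial X^j - X^i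
    directly.\<close>
  proof (cases "inj_on (\<lambda>k. (T ^^ k) u) {..card S}")
    case False
    then obtain i j where ij: "i < j" "(T ^^ i) u = (T ^^ j) u"
      unfolding inj_on_def by (metis linorder_neqE_nat)
    define p :: "'a poly" where "p = monom 1 j - monom 1 i"
    have c: "coeff p k = (if k = j then 1 else 0) - (if k = i then 1 else 0)" for k
      by (simp add: p_def)
    have deg: "degree p = j"
    proof (rule antisym)
      show "degree p \<le> j" by (rule degree_le) (use ij in \<open>auto simp: c\<close>)
      show "j \<le> degree p" by (rule le_degree) (use ij in \<open>auto simp: c\<close>)
    qed
    have "p \<noteq> 0" using deg ij c[of j] by auto
    moreover have "(\<Sum>k\<le>degree p. scale (coeff p k) ((T ^^ k) u)) = 0"
    proof -
      have "(\<Sum>k\<le>j. scale (coeff p k) ((T ^^ k) u))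
        = (\<Sum>k\<le>j. (if k = j then (T ^^ k) u else 0) - (if k = i then (T ^^ k) u else 0))"
        by (intro sum.cong refl) (auto simp: c)
      also have "\<dots> = 0"
        using ij by (simp add: sum_subtractf)
      finally show ?thesis by (simp add: deg)
    qed
    ultimately show ?thesis using Y by (auto simp: subspace_0)
  next
    case True
    let ?I = "(\<lambda>k. (T ^^ k) u) ` {..card S}"
    have "dependent ?I"
    proof (rule ccontr)
      assume "independent ?I"
      moreover have "?I \<subseteq> span S" using Tk U by auto
      ultimately have "card ?I \<le> card S" using independent_span_bound[OF U(2)] by blast
      then show False using card_image[OF True] by simp
    qed
    then obtain c where c: "\<exists>v\<in>?I. c v \<noteq> 0" "(\<Sum>v\<in>?I. scale (c v) v) = 0"
      using dependent_finite[of ?I] by auto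
    define p where "p = (\<Sum>k\<le>card S. monom (c ((T ^^ k) u)) k)"
    have cp: "coeff p k = (if k \<le> card S then c ((T ^^ k) u) else 0)" for k
      by (simp add: p_def coeff_sum)
    obtain k where "k \<le> card S" "c ((T ^^ k) u) \<noteq> 0" using c(1) by blast
    then have "p \<noteq> 0" using cp[of k] by auto
    moreover have "(\<Sum>k\<le>degree p. scale (coeff p k) ((T ^^ k) u)) = 0"
    proof -
      have "degree p \<le> card S" by (rule degree_le) (auto simp: cp)
      then have "(\<Sum>k\<le>degree p. scale (coeff p k) ((T ^^ k) u))
        = (\<Sum>k\<le>card S. scale (coeff p k) ((T ^^ k) u))"
        by (intro sum.mono_neutral_left) (auto simp: not_le coeff_eq_0)
      also have "\<dots> = (\<Sum>v\<in>?I. scale (c v) v)"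
        by (subst sum.reindex[OF True]) (auto simp: cp intro!: sum.cong)
      finally show ?thesis using c by simp
    qed
    ultimately show ?thesis using Y by (auto simp: subspace_0)
  qed
qed

text \<open>Take a nonzero p of least degree with p(T) u in \<open>Y\<close>. It is not constant
  because u is outside \<open>Y\<close>, so p = (X - l) q. Then v = q(T) u is outside
  \<open>Y\<close> by minimality, while (T - l) v = p(T) u.\<close>

lemma eigenvector_modulo:
  assumes T: "Vector_Spaces.linear scale scale T"
    and Y: "subspace Y" and U: "subspace U" "U \<subseteq> span S" "finite S" and TU: "T ` U \<subseteq> U"
    and u: "u \<in> U" "u \<notin> Y"
  shows "\<exists>v l. v \<in> U \<and> v \<notin> Y \<and> T v - scale l v \<in> Y"
proof -
  interpret T: Vector_Spaces.linear scale scale T by (rule T)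
  have Tk: "(T ^^ k) u \<in> U" for k
    using u TU by (induction k) auto
  let ?ev = "\<lambda>p. \<Sum>k\<le>degree p. scale (coeff p k) ((T ^^ k) u)"
  define ann where "ann p \<longleftrightarrow> p \<noteq> 0 \<and> ?ev p \<in> Y" for p
  obtain p0 where "ann p0"
    using poly_annihilates_modulo[OF T Y U(2,3) TU u(1)] unfolding ann_def by blast
  then obtain p where "ann p" and least_ann: "\<And>q. ann q \<Longrightarrow> degree p \<le> degree q"
    using ex_has_least_nat[of ann p0 degree] by blast
  then have p: "p \<noteq> 0" "?ev p \<in> Y" by (auto simp: ann_def)
  have least: "degree p \<le> degree q" if "q \<noteq> 0" "?ev q \<in> Y" for q
    using least_ann that by (simp add: ann_def)
  have "degree p > 0"
  proof (rule ccontr)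
    assume "\<not> degree p > 0"
    then obtain c where c: "p = [:c:]" using degree_eq_zeroE by (metis neq0_conv)
    then have "scale (inverse c) (scale c u) \<in> Y" using p Y subspace_scale[of Y "scale c u" "inverse c"] by auto
    then show False using c p u by simp
  qed
  then obtain l where "poly p l = 0" using alg_closed_imp_poly_has_root by blast
  then obtain q where q: "p = [:-l, 1:] * q" by (auto simp: poly_eq_0_iff_dvd dvd_def)
  then have q0: "q \<noteq> 0" using p by auto
  have degp: "degree p = Suc (degree q)"
    by (subst q, subst degree_mult_eq) (use q0 in auto)
  have nin: "?ev q \<notin> Y"
    using least[OF q0] degp by auto
  have in_U: "?ev q \<in> U" using U(1) Tk by (intro subspace_sum subspace_scale) auto
  have cp: "coeff p k = (if k = 0 then 0 else coeff q (k - 1)) - l * coeff q k" for k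
    by (cases k) (simp_all add: q coeff_pCons)
  have "?ev p = (\<Sum>k\<le>Suc (degree q). scale (coeff p k) ((T ^^ k) u))"
    using degp by simp
  also have "\<dots> = (\<Sum>k\<le>Suc (degree q). scale (if k = 0 then 0 else coeff q (k - 1)) ((T ^^ k) u))
      - (\<Sum>k\<le>Suc (degree q). scale (l * coeff q k) ((T ^^ k) u))"
    by (simp only: cp scale_left_diff_distrib sum_subtractf)
  also have "(\<Sum>k\<le>Suc (degree q). scale (if k = 0 then 0 else coeff q (k - 1)) ((T ^^ k) u)) = T (?ev q)"
    by (subst sum.atMost_Suc_shift) (simp add: T.sum T.scale)
  also have "(\<Sum>k\<le>Suc (degree q). scale (l * coeff q k) ((T ^^ k) u)) = scale l (?ev q)"
    unfolding scale_sum_right scale_scale by (intro sum.mono_neutral_right) (auto simp: not_le coeff_eq_0)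
  finally have "T (?ev q) - scale l (?ev q) \<in> Y" using p(2) by argo
  then show ?thesis using nin in_U by blast
qed


text \<open>Beyond ordinary triangularity, T - l i takes w i only to earlier vectors with the same
  diagonal entry. For a basis this encodes the decomposition into generalized eigenspaces together
  with a triangular form on each of them.\<close>

definition triangular :: "('b \<Rightarrow> 'b) \<Rightarrow> nat \<Rightarrow> (nat \<Rightarrow> 'b) \<Rightarrow> (nat \<Rightarrow> 'a) \<Rightarrow> bool" where
  "triangular T n w l \<longleftrightarrow>
     (\<forall>i<n. T (w i) - scale (l i) (w i) \<in> span (w ` {j. j < i \<and> l j = l i}))"

text \<open>On these vectors T - c is triangular with nonzero diagonal entries l i - c, so induction
  on i yields a preimage of each w i. General c serves to correct a new basis vector; c = 0 later
  gives preimages under T.\<close>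

lemma triangular_shift_surj:
  assumes T: "Vector_Spaces.linear scale scale T" and tri: "triangular T n w l"
  shows "span (w ` {j. j < n \<and> l j \<noteq> c})
    \<subseteq> (\<lambda>y. T y - scale c y) ` span (w ` {j. j < n \<and> l j \<noteq> c})" (is "_ \<subseteq> ?Z")
proof -
  interpret T: Vector_Spaces.linear scale scale T by (rule T)
  interpret Tc: Vector_Spaces.linear scale scale "\<lambda>y. T y - scale c y"
    by unfold_locales (auto simp: T.add T.scale algebra_simps)
  have sZ: "subspace ?Z"
    by (intro Tc.subspace_image subspace_span)
  have "w i \<in> ?Z" if "i < n" "l i \<noteq> c" for i
    using that
  proof (induction i rule: less_induct)
    case (less i)
    have "w ` {j. j < i \<and> l j = l i} \<subseteq> ?Z"
      using less by force
    then have "span (w ` {j. j < i \<and> l j = l i}) \<subseteq> ?Z"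
      using sZ by (rule span_minimal)
    then have a: "T (w i) - scale (l i) (w i) \<in> ?Z"
      using tri less.prems by (auto simp: triangular_def)
    have b: "T (w i) - scale c (w i) \<in> ?Z"
      using less.prems by (intro imageI span_base) auto
    have "scale (inverse (l i - c)) ((T (w i) - scale c (w i)) - (T (w i) - scale (l i) (w i))) \<in> ?Z"
      by (intro subspace_scale subspace_diff sZ a b)
    also have "(T (w i) - scale c (w i)) - (T (w i) - scale (l i) (w i)) = scale (l i - c) (w i)"
      by (simp add: algebra_simps)
    finally show ?case using less.prems by force
  qed
  then show ?thesis using sZ by (intro span_minimal) auto
qed

text \<open>A triangular independent family in \<open>U\<close> of greatest length must span
  \<open>U\<close>: otherwise an eigenvector modulo its span, suitably corrected, would prolong
  it.\<close>

lemma exists_triangular_basis: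
  assumes T: "Vector_Spaces.linear scale scale T"
    and U: "subspace U" "U \<subseteq> span S" "finite S" and TU: "T ` U \<subseteq> U"
  obtains n w l where "inj_on w {..<n}" "independent (w ` {..<n})" "span (w ` {..<n}) = U"
    "triangular T n w l"
proof -
  interpret T: Vector_Spaces.linear scale scale T by (rule T)
  define tri where "tri n w l \<longleftrightarrow> inj_on w {..<n} \<and> independent (w ` {..<n}) \<and> w ` {..<n} \<subseteq> U \<and>
    triangular T n w l" for n w l
  have "tri 0 w l" for w l by (simp add: tri_def triangular_def independent_empty)
  moreover have le: "n \<le> card S" if "tri n w l" for n w l
  proof -
    have "card (w ` {..<n}) \<le> card S"
      using that U independent_span_bound[of S "w ` {..<n}"] by (auto simp: tri_def)
    then show ?thesis using that by (simp add: tri_def card_image)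
  qed
  ultimately obtain n where "\<exists>w l. tri n w l" and greatest: "\<And>m w l. tri m w l \<Longrightarrow> m \<le> n"
    using Nat.ex_has_greatest_nat[of "\<lambda>n. \<exists>w l. tri n w l" 0 "card S"] by blast
  then obtain w l where nwl: "tri n w l" by blast
  have sub: "span (w ` {..<n}) \<subseteq> U"
    using nwl U(1) by (intro span_minimal) (auto simp: tri_def)
  have "U \<subseteq> span (w ` {..<n})"
  proof (rule ccontr)
    assume "\<not> U \<subseteq> span (w ` {..<n})"
    then obtain u0 where "u0 \<in> U" "u0 \<notin> span (w ` {..<n})" by blast
    then obtain v c where v: "v \<in> U" "v \<notin> span (w ` {..<n})"
      and Tv: "T v - scale c v \<in> span (w ` {..<n})"
      using eigenvector_modulo[OF T subspace_span U TU] by blast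
    txt \<open>The components of \<open>T v - c v\<close> of weight other than \<open>c\<close> are removed by changing \<open>v\<close>.\<close>
    have "w ` {..<n} = w ` {j. j < n \<and> l j = c} \<union> w ` {j. j < n \<and> l j \<noteq> c}" by auto
    then obtain y z where yz: "T v - scale c v = y + z" "y \<in> span (w ` {j. j < n \<and> l j = c})"
        "z \<in> span (w ` {j. j < n \<and> l j \<noteq> c})"
      using Tv by (auto simp: span_Un)
    then obtain x where x: "x \<in> span (w ` {j. j < n \<and> l j \<noteq> c})" "T x - scale c x = z"
      using triangular_shift_surj[OF T, of n w l c] nwl by (auto simp: tri_def)
    have xs: "x \<in> span (w ` {..<n})" using x span_mono[of "w ` {j. j < n \<and> l j \<noteq> c}" "w ` {..<n}"] by auto
    have Tvx: "T (v - x) - scale c (v - x) = y"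
      using yz x by (simp add: T.diff algebra_simps)
    have vx: "v - x \<notin> span (w ` {..<n})" using v xs span_add[of "v - x" _ x] by auto
    have vx_ne: "w j \<noteq> v - x" if "j < n" for j
      using vx that span_base[of "w j" "w ` {..<n}"] by auto
    have "v - x \<in> U" using v xs sub U by (auto intro: subspace_diff)
    let ?w = "w(n := v - x)" and ?l = "l(n := c)"
    have im: "?w ` {..<Suc n} = insert (v - x) (w ` {..<n})" by (auto simp: lessThan_Suc)
    have im2: "?w ` {j. j < i \<and> ?l j = ?l i} = w ` {j. j < i \<and> l j = ?l i}" if "i \<le> n" for i
      using that by (intro image_cong) auto
    have "tri (Suc n) ?w ?l"
      unfolding tri_def im
    proof (intro conjI)
      show "inj_on ?w {..<Suc n}"
      proof (rule inj_onI)
        fix i j assume "i \<in> {..<Suc n}" "j \<in> {..<Suc n}" "?w i = ?w j"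
        then show "i = j"
          using nwl vx_ne[of i] vx_ne[of j] by (auto simp: tri_def less_Suc_eq inj_on_eq_iff split: if_splits)
      qed
      show "independent (insert (v - x) (w ` {..<n}))"
        using nwl vx by (auto simp: tri_def independent_insert)
      show "insert (v - x) (w ` {..<n}) \<subseteq> U"
        using nwl \<open>v - x \<in> U\<close> by (auto simp: tri_def)
      show "triangular T (Suc n) ?w ?l"
        unfolding triangular_def
      proof (intro allI impI)
        fix i assume "i < Suc n"
        then have "i \<le> n" by simp
        show "T (?w i) - scale (?l i) (?w i) \<in> span (?w ` {j. j < i \<and> ?l j = ?l i})"
          unfolding im2[OF \<open>i \<le> n\<close>]
          using nwl \<open>i \<le> n\<close> Tvx yz by (auto simp: tri_def triangular_def)
      qed
    qed
    then show False using greatest by fastforce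
  qed
  then show ?thesis
    using nwl sub that[of w n l] by (auto simp: tri_def)
qed

end

text \<open>This interface keeps what the construction of replicas takes from the eigenspace
  decomposition. \<open>weight_br\<close> says that brackets add weights, and
  \<open>coord_diag\<close> serves the trace computation. Coordinates are controlled only on
  \<open>U\<close>, which will sit inside a larger type of functions.\<close>

locale weight_basis = alg_closed_vector_space scale
  for scale :: "'a::alg_closed_field \<Rightarrow> 'b::ab_group_add \<Rightarrow> 'b" +
  fixes T :: "'b \<Rightarrow> 'b" and U :: "'b set" and br :: "'b \<Rightarrow> 'b \<Rightarrow> 'b"
    and n :: nat and w :: "nat \<Rightarrow> 'b" and l :: "nat \<Rightarrow> 'a" and Q :: "nat \<Rightarrow> 'b \<Rightarrow> 'a"
  assumes subspace_U: "subspace U"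
    and br_left: "\<And>v. Vector_Spaces.linear scale scale (\<lambda>u. br u v)"
    and br_right: "\<And>u. Vector_Spaces.linear scale scale (br u)"
    and br_closed: "\<And>u v. u \<in> U \<Longrightarrow> v \<in> U \<Longrightarrow> br u v \<in> U"
    and expand: "\<And>u. u \<in> U \<Longrightarrow> u = (\<Sum>i<n. scale (Q i u) (w i))"
    and coord_add: "\<And>i u v. u \<in> U \<Longrightarrow> v \<in> U \<Longrightarrow> Q i (u + v) = Q i u + Q i v"
    and coord_scale: "\<And>i c u. u \<in> U \<Longrightarrow> Q i (scale c u) = c * Q i u"
    and basis_closed: "\<And>i. i < n \<Longrightarrow> w i \<in> U"
    and coord_diag: "\<And>i. i < n \<Longrightarrow> Q i (T (w i)) = l i"
    and basis_range: "\<And>i k. i < n \<Longrightarrow> l i \<noteq> 0 \<Longrightarrow> w i \<in> (T ^^ k) ` U"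
    and weights_zero: "\<And>u. (\<And>i. i < n \<Longrightarrow> l i = 0) \<Longrightarrow> u \<in> U \<Longrightarrow> (T ^^ n) u = 0"
    and weight_br: "\<And>i j k. i < n \<Longrightarrow> j < n \<Longrightarrow> k < n \<Longrightarrow> Q k (br (w i) (w j)) \<noteq> 0 \<Longrightarrow> l k = l i + l j"
begin

lemma coord_sum:
  assumes "\<And>x. x \<in> A \<Longrightarrow> g x \<in> U"
  shows "Q i (\<Sum>x\<in>A. g x) = (\<Sum>x\<in>A. Q i (g x))"
  using assms
proof (induction A rule: infinite_finite_induct)
  case (insert x A)
  then have "Q i (g x + sum g A) = Q i (g x) + Q i (sum g A)"
    by (intro coord_add subspace_sum subspace_U) auto
  then show ?case using insert by simp
qed (use coord_scale[of 0 i 0] subspace_0[OF subspace_U] in simp_all)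

definition weight_map :: "('a \<Rightarrow> 'a) \<Rightarrow> 'b \<Rightarrow> 'b" where
  "weight_map f u = (\<Sum>i<n. scale (f (l i) * Q i u) (w i))"

lemma weight_map_add: "u \<in> U \<Longrightarrow> v \<in> U \<Longrightarrow> weight_map f (u + v) = weight_map f u + weight_map f v"
  by (simp add: weight_map_def coord_add distrib_left scale_left_distrib sum.distrib)

lemma weight_map_scale: "u \<in> U \<Longrightarrow> weight_map f (scale c u) = scale c (weight_map f u)"
  by (simp add: weight_map_def coord_scale scale_sum_right mult.left_commute)

lemma weight_map_sum:
  assumes "\<And>i. i \<in> A \<Longrightarrow> g i \<in> U"
  shows "weight_map f (\<Sum>i\<in>A. g i) = (\<Sum>i\<in>A. weight_map f (g i))"
  using assms
proof (induction A rule: infinite_finite_induct)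
  case (insert x A)
  then have "weight_map f (g x + sum g A) = weight_map f (g x) + weight_map f (sum g A)"
    by (intro weight_map_add subspace_sum subspace_U) auto
  then show ?case using insert by simp
qed (use weight_map_scale[of 0 f 0] subspace_0[OF subspace_U] in simp_all)

text \<open>Only basis vectors of weight l i + l j occur in the bracket, and additivity of f gives
  all of them the same factor.\<close>

lemma weight_map_br_basis:
  assumes f: "\<And>y z. f (y + z) = f y + f z" and ij: "i < n" "j < n"
  shows "weight_map f (br (w i) (w j)) = scale (f (l i) + f (l j)) (br (w i) (w j))"
proof -
  have "weight_map f (br (w i) (w j)) = (\<Sum>k<n. scale (f (l i) + f (l j)) (scale (Q k (br (w i) (w j))) (w k)))"
    unfolding weight_map_def
  proof (intro sum.cong refl)
    fix k assume "k \<in> {..<n}"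
    then show "scale (f (l k) * Q k (br (w i) (w j))) (w k)
      = scale (f (l i) + f (l j)) (scale (Q k (br (w i) (w j))) (w k))"
      using weight_br[OF ij, of k] by (cases "Q k (br (w i) (w j)) = 0") (auto simp: f)
  qed
  also have "\<dots> = scale (f (l i) + f (l j)) (\<Sum>k<n. scale (Q k (br (w i) (w j))) (w k))"
    by (simp only: scale_sum_right)
  finally show ?thesis
    unfolding expand[OF br_closed[OF basis_closed basis_closed, OF ij], symmetric] .
qed

lemma br_combination:
  "br (\<Sum>i<n. scale (p i) (w i)) (\<Sum>j<n. scale (q j) (w j))
    = (\<Sum>i<n. \<Sum>j<n. scale (p i * q j) (br (w i) (w j)))"
proof -
  interpret left: Vector_Spaces.linear scale scale "\<lambda>u. br u v" for v by (rule br_left)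
  interpret right: Vector_Spaces.linear scale scale "br u" for u by (rule br_right)
  show ?thesis
    by (simp add: left.sum left.scale right.sum right.scale scale_sum_right)
      (subst sum.swap, simp add: mult.commute)
qed

text \<open>By bilinearity it is enough to treat brackets of basis vectors, whose factor f (l i) + f
  (l j) splits into one summand for each argument.\<close>

lemma weight_map_derivation:
  assumes f: "\<And>y z. f (y + z) = f y + f z" and uv: "u \<in> U" "v \<in> U"
  shows "weight_map f (br u v) = br (weight_map f u) v + br u (weight_map f v)"
proof -
  have closed: "scale c (br (w i) (w j)) \<in> U" if "i \<in> {..<n}" "j \<in> {..<n}" for c i j
    using that by (intro subspace_scale subspace_U br_closed basis_closed) auto
  have "weight_map f (br u v) = weight_map f (\<Sum>i<n. \<Sum>j<n. scale (Q i u * Q j v) (br (w i) (w j)))"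
    unfolding br_combination[symmetric] expand[OF uv(1), symmetric] expand[OF uv(2), symmetric] by (rule refl)
  also have "\<dots> = (\<Sum>i<n. \<Sum>j<n. weight_map f (scale (Q i u * Q j v) (br (w i) (w j))))"
  proof -
    have row: "(\<Sum>j<n. scale (Q i u * Q j v) (br (w i) (w j))) \<in> U" if "i \<in> {..<n}" for i
      using closed[OF that] by (intro subspace_sum subspace_U)
    have "weight_map f (\<Sum>i<n. \<Sum>j<n. scale (Q i u * Q j v) (br (w i) (w j)))
        = (\<Sum>i<n. weight_map f (\<Sum>j<n. scale (Q i u * Q j v) (br (w i) (w j))))"
      by (rule weight_map_sum) (rule row)
    also have "\<dots> = (\<Sum>i<n. \<Sum>j<n. weight_map f (scale (Q i u * Q j v) (br (w i) (w j))))"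
      by (rule sum.cong[OF refl], rule weight_map_sum, rule closed)
    finally show ?thesis .
  qed
  also have "\<dots> = (\<Sum>i<n. \<Sum>j<n. scale (Q i u * Q j v) (scale (f (l i) + f (l j)) (br (w i) (w j))))"
    by (intro sum.cong refl)
      (simp add: weight_map_scale br_closed basis_closed weight_map_br_basis[where f = f, OF f])
  also have "\<dots> = (\<Sum>i<n. \<Sum>j<n. scale ((f (l i) * Q i u) * Q j v) (br (w i) (w j)))
      + (\<Sum>i<n. \<Sum>j<n. scale (Q i u * (f (l j) * Q j v)) (br (w i) (w j)))"
    unfolding sum.distrib[symmetric] scale_left_distrib[symmetric] scale_scale
    by (intro sum.cong refl arg_cong2[where f = scale]) (simp add: distrib_left mult.commute mult.left_commute)
  also have "\<dots> = br (weight_map f u) v + br u (weight_map f v)"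
    unfolding br_combination[symmetric] weight_map_def
      expand[OF uv(1), symmetric] expand[OF uv(2), symmetric] by (rule refl)
  finally show ?thesis .
qed

text \<open>Since f 0 = 0, only basis vectors of nonzero weight contribute, and
  \<open>basis_range\<close> puts these into the image of each power of T.\<close>

lemma weight_map_range:
  assumes T: "Vector_Spaces.linear scale scale T" and f: "f 0 = 0"
  shows "weight_map f u \<in> (T ^^ k) ` U"
proof -
  interpret Tk: Vector_Spaces.linear scale scale "T ^^ k" by (rule linear_funpow[OF T])
  have S: "subspace ((T ^^ k) ` U)" by (intro Tk.subspace_image subspace_U)
  have "scale (f (l i) * Q i u) (w i) \<in> (T ^^ k) ` U" if "i < n" for i
    using basis_range[OF that] subspace_scale[OF S] subspace_0[OF S]
    by (cases "l i = 0") (auto simp: f)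
  then show ?thesis
    unfolding weight_map_def by (intro subspace_sum S) auto
qed

end

section \<open>Existence of a basis of weight vectors for a derivation\<close>

context alg_closed_vector_space
begin

lemma exists_weight_basis:
  assumes T: "Vector_Spaces.linear scale scale T"
    and U: "subspace U" "U \<subseteq> span S" "finite S" and TU: "T ` U \<subseteq> U"
    and br_left: "\<And>v. Vector_Spaces.linear scale scale (\<lambda>u. br u v)"
    and br_right: "\<And>u. Vector_Spaces.linear scale scale (br u)"
    and br_U: "\<And>u v. u \<in> U \<Longrightarrow> v \<in> U \<Longrightarrow> br u v \<in> U"
    and der: "\<And>u v. u \<in> U \<Longrightarrow> v \<in> U \<Longrightarrow> T (br u v) = br (T u) v + br u (T v)"
  shows "\<exists>n w l Q. weight_basis scale T U br n w l Q"
proof -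
  interpret T: Vector_Spaces.linear scale scale T by (rule T)
  obtain n w l where inj: "inj_on w {..<n}" and ind: "independent (w ` {..<n})"
    and span: "span (w ` {..<n}) = U" and tri: "triangular T n w l"
    using exists_triangular_basis[OF T U TU] by blast
  define Q where "Q i u = representation (w ` {..<n}) u (w i)" for i u
  have expand: "u = (\<Sum>i<n. scale (Q i u) (w i))" if "u \<in> U" for u
    using sum_representation_eq[OF ind, of u "w ` {..<n}"] that span
    by (simp add: sum.reindex[OF inj] Q_def)
  have Q_add: "Q i (u + v) = Q i u + Q i v" if "u \<in> U" "v \<in> U" for i u v
    using that span by (simp add: Q_def representation_add[OF ind])
  have Q_scale: "Q i (scale c u) = c * Q i u" if "u \<in> U" for i c u
    using that span by (simp add: Q_def representation_scale[OF ind])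
  have Q_sum: "Q i (\<Sum>x\<in>A. g x) = (\<Sum>x\<in>A. Q i (g x))" if "\<And>x. x \<in> A \<Longrightarrow> g x \<in> U" for i g and A :: "nat set"
    using that span by (simp add: Q_def representation_sum[OF ind])
  have Q_comb: "Q k (scale c u + (\<Sum>m<n. scale (a m) (z m))) = c * Q k u + (\<Sum>m<n. a m * Q k (z m))"
    if "u \<in> U" "\<And>m. m < n \<Longrightarrow> z m \<in> U" for k c u a z
  proof -
    have z: "scale (a m) (z m) \<in> U" if "m \<in> {..<n}" for m
      using that \<open>\<And>m. m < n \<Longrightarrow> z m \<in> U\<close> U(1) by (auto intro: subspace_scale)
    have "Q k (\<Sum>m<n. scale (a m) (z m)) = (\<Sum>m<n. a m * Q k (z m))"
      using that(2) by (subst Q_sum[OF z]) (auto simp: Q_scale)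
    moreover have "(\<Sum>m<n. scale (a m) (z m)) \<in> U"
      using z U(1) by (intro subspace_sum)
    ultimately show ?thesis
      using that(1) U(1) by (simp add: Q_add Q_scale subspace_scale)
  qed
  have wU: "w i \<in> U" if "i < n" for i
    using that span span_base[of "w i" "w ` {..<n}"] by auto
  have Qw: "Q i (w j) = (if i = j then 1 else 0)" if "i < n" "j < n" for i j
    using that inj by (auto simp: Q_def representation_basis[OF ind] inj_on_eq_iff)
  define N where "N m i = Q m (T (w i) - scale (l i) (w i))" for m i
  have N_nz: "m < i \<and> l m = l i" if "N m i \<noteq> 0" "m < n" "i < n" for m i
  proof -
    have "w ` {j. j < i \<and> l j = l i} \<subseteq> w ` {..<n}" using that by auto
    moreover have "T (w i) - scale (l i) (w i) \<in> span (w ` {j. j < i \<and> l j = l i})"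
      using tri that by (auto simp: triangular_def)
    ultimately have "N m i = representation (w ` {j. j < i \<and> l j = l i}) (T (w i) - scale (l i) (w i)) (w m)"
      unfolding N_def Q_def using representation_extend[OF ind] by metis
    then have "w m \<in> w ` {j. j < i \<and> l j = l i}"
      using that representation_ne_zero by metis
    then show ?thesis using that inj by (auto simp: inj_on_eq_iff)
  qed
  have TwU: "T (w i) - scale (l i) (w i) \<in> U" if "i < n" for i
    using that TU wU U(1) by (auto intro!: subspace_diff subspace_scale)
  have Tw: "T (w i) = scale (l i) (w i) + (\<Sum>m<n. scale (N m i) (w m))" if "i < n" for i
    using expand[OF TwU[OF that]] by (simp add: N_def algebra_simps)
  have QTw: "Q m (T (w i)) = (if m = i then l i else 0) + N m i" if "i < n" "m < n" for i m
  proof -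
    have "Q m (T (w i)) = Q m (scale (l i) (w i) + (T (w i) - scale (l i) (w i)))" by simp
    also have "\<dots> = l i * Q m (w i) + N m i"
      using that wU TwU U(1) by (subst Q_add) (auto simp: Q_scale N_def subspace_scale)
    finally show ?thesis using that by (simp add: Qw)
  qed
  \<comment> \<open>This reads T along row k of its matrix: only m > k with l m = l k contribute to
    the sum, so passing from k to m lowers n - k in the induction below.\<close>
  have Q_T: "Q k (T z) = l k * Q k z + (\<Sum>m<n. Q m z * N k m)" if "z \<in> U" "k < n" for z k
  proof -
    have "Q k (T z) = Q k (\<Sum>m<n. scale (Q m z) (T (w m)))"
      by (subst expand[OF that(1)]) (simp add: T.sum T.scale)
    also have "\<dots> = (\<Sum>m<n. Q m z * Q k (T (w m)))"
      using wU TU U(1) by (subst Q_sum) (auto simp: Q_scale subspace_scale image_subset_iff)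
    also have "\<dots> = (\<Sum>m<n. (if k = m then l m * Q m z else 0) + Q m z * N k m)"
      using that by (intro sum.cong) (auto simp: QTw algebra_simps)
    finally show ?thesis using that by (simp add: sum.distrib)
  qed
  txt \<open>
    The off-diagonal part \<open>N\<close> of \<open>T\<close> is strictly triangular and preserves weights, so in the derivation
    identity it only contributes structure constants with smaller \<open>i + j + (n - k)\<close>.
  \<close>
  have weights: "Q k (br (w i) (w j)) = 0" if "i < n" "j < n" "k < n" "l k \<noteq> l i + l j" for i j k
    using that
  proof (induction "i + j + (n - k)" arbitrary: i j k rule: less_induct)
    case less
    interpret bl: Vector_Spaces.linear scale scale "\<lambda>u. br u (w j)" by (rule br_left)
    interpret br: Vector_Spaces.linear scale scale "br (w i)" by (rule br_right)
    have brU: "br (w i) (w m) \<in> U" "br (w m) (w j) \<in> U" if "m < n" for m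
      using less.prems that wU br_U by auto
    have "Q k (T (br (w i) (w j))) = l k * Q k (br (w i) (w j))"
    proof -
      have "Q m (br (w i) (w j)) * N k m = 0" if "m < n" for m
        using N_nz[of k m] less.hyps[of i j m] less.prems that by force
      then have "(\<Sum>m<n. Q m (br (w i) (w j)) * N k m) = 0"
        by (intro sum.neutral) simp
      then show ?thesis
        using Q_T[of "br (w i) (w j)" k] less.prems brU by simp
    qed
    moreover have "Q k (br (T (w i)) (w j)) = l i * Q k (br (w i) (w j))"
    proof -
      have "Q k (br (T (w i)) (w j)) = l i * Q k (br (w i) (w j)) + (\<Sum>m<n. N m i * Q k (br (w m) (w j)))"
        using less.prems brU by (simp add: Tw bl.add bl.scale bl.sum Q_comb)
      moreover have "N m i * Q k (br (w m) (w j)) = 0" if "m < n" for m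
        using N_nz[of m i] less.hyps[of m j k] less.prems that by force
      ultimately show ?thesis by simp
    qed
    moreover have "Q k (br (w i) (T (w j))) = l j * Q k (br (w i) (w j))"
    proof -
      have "Q k (br (w i) (T (w j))) = l j * Q k (br (w i) (w j)) + (\<Sum>m<n. N m j * Q k (br (w i) (w m)))"
        using less.prems brU by (simp add: Tw br.add br.scale br.sum Q_comb)
      moreover have "N m j * Q k (br (w i) (w m)) = 0" if "m < n" for m
        using N_nz[of m j] less.hyps[of i m k] less.prems that by force
      ultimately show ?thesis by simp
    qed
    moreover have "Q k (T (br (w i) (w j))) = Q k (br (T (w i)) (w j)) + Q k (br (w i) (T (w j)))"
      using less.prems TU wU by (subst der) (auto intro!: Q_add br_U)
    ultimately have "(l k - (l i + l j)) * Q k (br (w i) (w j)) = 0"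
      by (simp add: algebra_simps)
    then show ?case using less.prems by simp
  qed
  have range: "w i \<in> (T ^^ k) ` U" if "i < n" "l i \<noteq> 0" for i k
  proof -
    let ?Z = "span (w ` {j. j < n \<and> l j \<noteq> 0})"
    \<comment> \<open>For c = 0 the shifted map is T itself, and the inclusion can be
      iterated.\<close>
    have "?Z \<subseteq> T ` ?Z" using triangular_shift_surj[OF T tri, of 0] by simp
    then have "?Z \<subseteq> (T ^^ k) ` ?Z"
      by (induction k) (auto simp: image_comp [symmetric], blast)
    moreover have "w i \<in> ?Z" using that by (intro span_base) auto
    moreover have "?Z \<subseteq> U" unfolding span[symmetric] by (intro span_mono) auto
    ultimately show ?thesis by blast
  qed
  have nilpotent: "\<forall>u\<in>U. (T ^^ n) u = 0" if "\<And>i. i < n \<Longrightarrow> l i = 0"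
  proof -
    have Tk: "Vector_Spaces.linear scale scale (T ^^ k)" for k
      by (rule linear_funpow[OF T])
    \<comment> \<open>With all weights zero T is strictly triangular, so T^k kills the first k basis
      vectors.\<close>
    have "(T ^^ k) (w i) = 0" if "i < k" "i < n" for i k
      using that
    proof (induction k arbitrary: i)
      case (Suc k)
      interpret Tk: Vector_Spaces.linear scale scale "T ^^ k" by (rule Tk)
      have "(T ^^ Suc k) (w i) = (\<Sum>m<n. scale (N m i) ((T ^^ k) (w m)))"
        using Suc.prems \<open>\<And>i. i < n \<Longrightarrow> l i = 0\<close>
        by (simp add: funpow_swap1 Tw Tk.sum Tk.scale)
      also have "\<dots> = 0"
      proof (intro sum.neutral ballI)
        fix m assume "m \<in> {..<n}"
        then show "scale (N m i) ((T ^^ k) (w m)) = 0"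
          using N_nz[of m i] Suc.IH[of m] Suc.prems by force
      qed
      finally show ?case .
    qed simp
    moreover interpret Tn: Vector_Spaces.linear scale scale "T ^^ n" by (rule Tk)
    show ?thesis
    proof
      fix u assume "u \<in> U"
      have "(T ^^ n) u = (\<Sum>i<n. scale (Q i u) ((T ^^ n) (w i)))"
        by (subst expand[OF \<open>u \<in> U\<close>]) (simp add: Tn.sum Tn.scale)
      then show "(T ^^ n) u = 0" using calculation by simp
    qed
  qed
  have diag: "Q i (T (w i)) = l i" if "i < n" for i
    using QTw[OF that that] N_nz[of i i] that by auto
  have weights': "l k = l i + l j" if "i < n" "j < n" "k < n" "Q k (br (w i) (w j)) \<noteq> 0" for i j k
    using weights that by blast
  have "weight_basis scale T U br n w l Q"
    by (intro weight_basis.intro weight_basis_axioms.intro alg_closed_vector_space_axioms)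
      (fact U(1) br_left br_right br_U expand Q_add Q_scale wU diag range nilpotent[rule_format] weights')+
  then show ?thesis by blast
qed

end

section \<open>Linear functionals with a prescribed nonzero value\<close>

lemma sum_fun_apply: "(\<Sum>i\<in>A. g i) x = (\<Sum>i\<in>A. g i x)"
  by (induction A rule: infinite_finite_induct) simp_all

lemma (in vector_space) exists_functional:
  assumes "x \<noteq> 0"
  obtains f where "Vector_Spaces.linear scale (*) f" "f x = 1"
proof -
  interpret F: vector_space "(*) :: 'a \<Rightarrow> 'a \<Rightarrow> 'a"
    by unfold_locales (auto simp: algebra_simps)
  interpret vector_space_pair scale "(*) :: 'a \<Rightarrow> 'a \<Rightarrow> 'a" ..
  have "independent {x}" using assms by simp
  from linear_independent_extend[OF this, of "\<lambda>_. 1"] that show ?thesis by auto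
qed

text \<open>A field of characteristic zero is a vector space over the rationals. Rational values
  matter because a sum of squares of rationals vanishes only if every term does.\<close>

lemma exists_rational_functional:
  fixes x :: "'a::field_char_0"
  assumes "x \<noteq> 0"
  obtains f :: "'a \<Rightarrow> rat" where "\<And>y z. f (y + z) = f y + f z" "\<And>q y. f (of_rat q * y) = q * f y" "f x = 1"
proof -
  interpret vector_space "\<lambda>q (y::'a). of_rat q * y"
    by unfold_locales (auto simp: algebra_simps of_rat_add of_rat_mult)
  obtain f where "Vector_Spaces.linear (\<lambda>q (y::'a). of_rat q * y) (*) f" "f x = 1"
    using exists_functional[OF assms] .
  then show ?thesis using that by (auto simp: Vector_Spaces.linear_iff)
qed

text \<open>The closure is a vector space over \<open>'a\<close> by way of \<open>to_ac\<close>.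
  Applied to coordinates, such a functional brings vectors over the closure back to the original
  field.\<close>

lemma exists_descent_functional:
  fixes x :: "'a::field alg_closure"
  assumes "x \<noteq> 0"
  obtains f :: "'a alg_closure \<Rightarrow> 'a" where "\<And>y z. f (y + z) = f y + f z" "\<And>c y. f (to_ac c * y) = c * f y" "f x = 1"
proof -
  interpret vector_space "\<lambda>c (y::'a alg_closure). to_ac c * y"
    by unfold_locales (auto simp: algebra_simps)
  obtain f where "Vector_Spaces.linear (\<lambda>c (y::'a alg_closure). to_ac c * y) (*) f" "f x = 1"
    using exists_functional[OF assms] .
  then show ?thesis using that by (auto simp: Vector_Spaces.linear_iff)
qed

section \<open>Replicas of a derivation\<close>

definition (in finite_dimensional_vector_space) trace :: "('b \<Rightarrow> 'b) \<Rightarrow> 'a" where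
  "trace f = (\<Sum>b\<in>Basis. representation Basis (f b) b)"

locale fd_space_char_0 = finite_dimensional_vector_space scale Basis
  for scale :: "'k::field_char_0 \<Rightarrow> 'v::ab_group_add \<Rightarrow> 'v" and Basis
begin

text \<open>A weight map over the closure need not be defined over K. Applying a K-linear functional
  h to coordinates commutes with all matrices over K; on embedded vectors the derivation identity
  and the ranges involve only such matrices, so they survive the descent.\<close>

lemma exists_replica:
  assumes D: "Vector_Spaces.linear scale scale D"
    and br_left: "\<And>y. Vector_Spaces.linear scale scale (\<lambda>x. br x y)"
    and br_right: "\<And>x. Vector_Spaces.linear scale scale (br x)"
    and der: "\<And>x y. D (br x y) = br (D x) y + br x (D y)"
    and not_nilpotent: "\<And>k. \<exists>x. (D ^^ k) x \<noteq> 0"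
  obtains E where "Vector_Spaces.linear scale scale E"
    "\<And>x y. E (br x y) = br (E x) y + br x (E y)"
    "\<And>k. range E \<subseteq> range (D ^^ k)"
    "trace (\<lambda>x. D (E x)) \<noteq> 0"
proof -
  interpret D: Vector_Spaces.linear scale scale D by (rule D)
  define co where "co x b = representation Basis x b" for x b
  have co_add: "co (x + y) b = co x b + co y b" for x y b
    by (simp add: co_def representation_add independent_Basis span_Basis)
  have co_scale: "co (scale c x) b = c * co x b" for c x b
    by (simp add: co_def representation_scale independent_Basis span_Basis)
  have co_Basis: "co a b = (if a = b then 1 else 0)" if "a \<in> Basis" for a b
    using that by (auto simp: co_def representation_basis independent_Basis)
  have co_expand: "(\<Sum>b\<in>Basis. scale (co x b) b) = x" for x
    using sum_representation_eq[OF independent_Basis, of x Basis]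
    by (simp add: co_def span_Basis finite_Basis)
  have co_sum: "co (\<Sum>i\<in>A. g i) b = (\<Sum>i\<in>A. co (g i) b)" for g :: "'v \<Rightarrow> 'v" and A b
    by (simp add: co_def representation_sum independent_Basis span_Basis)
  have co_out: "co x b = 0" if "b \<notin> Basis" for x b
    using that representation_ne_zero by (auto simp: co_def)

  txt \<open>
    The scalar extension is modelled by functions vanishing off \<open>Basis\<close>, the subspace \<open>U\<close> below of a
    space of functions on the whole type.
  \<close>
  define sc :: "'k alg_closure \<Rightarrow> ('v \<Rightarrow> 'k alg_closure) \<Rightarrow> ('v \<Rightarrow> 'k alg_closure)"
    where "sc c u = (\<lambda>b. c * u b)" for c u
  interpret F: alg_closed_vector_space sc
    by unfold_locales (auto simp: sc_def fun_eq_iff algebra_simps)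
  have sc_apply: "sc c u b = c * u b" for c u b
    by (simp add: sc_def)
  define emb where "emb x = (\<lambda>b. to_ac (co x b))" for x
  have emb_add: "emb (x + y) = emb x + emb y" for x y
    by (simp add: emb_def fun_eq_iff co_add)
  have emb_scale: "emb (scale c x) = sc (to_ac c) (emb x)" for c x
    by (simp add: emb_def fun_eq_iff co_scale sc_def)
  have emb_sum: "emb (\<Sum>i\<in>A. g i) = (\<Sum>i\<in>A. emb (g i))" for g :: "'v \<Rightarrow> 'v" and A
    by (simp add: emb_def fun_eq_iff co_sum sum_fun_apply to_ac_sum)
  have emb_0: "emb x = 0 \<longleftrightarrow> x = 0" for x
  proof
    assume "emb x = 0"
    then have "co x b = 0" for b by (metis emb_def to_ac_eq_0_iff zero_fun_apply)
    then show "x = 0" using co_expand[of x] by simp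
  qed (simp add: emb_def co_def fun_eq_iff representation_zero)

  define U where "U = {u :: 'v \<Rightarrow> 'k alg_closure. \<forall>b. b \<notin> Basis \<longrightarrow> u b = 0}"
  have embU: "emb x \<in> U" for x by (simp add: U_def emb_def co_out)
  have U: "F.subspace U" by (auto simp: F.subspace_def U_def sc_def)
  have expandU: "u = (\<Sum>b\<in>Basis. sc (u b) (emb b))" if "u \<in> U" for u
  proof
    fix x
    have "(\<Sum>b\<in>Basis. sc (u b) (emb b)) x = (\<Sum>b\<in>Basis. if b = x then u b else 0)"
      by (auto simp: sum_fun_apply sc_def emb_def co_Basis intro!: sum.cong)
    also have "\<dots> = u x" using that by (simp add: finite_Basis U_def)
    finally show "u x = (\<Sum>b\<in>Basis. sc (u b) (emb b)) x" by simp
  qed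
  have U_span: "U \<subseteq> F.span (emb ` Basis)"
  proof
    fix u assume "u \<in> U"
    have "(\<Sum>b\<in>Basis. sc (u b) (emb b)) \<in> F.span (emb ` Basis)"
      by (intro F.span_sum F.span_scale F.span_base imageI)
    then show "u \<in> F.span (emb ` Basis)" using expandU[OF \<open>u \<in> U\<close>] by simp
  qed
  define lift where "lift g u = (\<Sum>b\<in>Basis. sc (u b) (emb (g b)))" for g u
  have lift_linear: "Vector_Spaces.linear sc sc (lift g)" for g
    by unfold_locales
      (simp_all add: lift_def sc_apply F.scale_left_distrib sum.distrib F.scale_sum_right)
  have lift_U: "lift g u \<in> U" for g u
    unfolding lift_def by (intro F.subspace_sum U F.subspace_scale embU)
  have lift_emb: "lift g (emb x) = emb (g x)" if "Vector_Spaces.linear scale scale g" for g x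
  proof -
    interpret g: Vector_Spaces.linear scale scale g by (rule that)
    have "emb (g x) = emb (g (\<Sum>b\<in>Basis. scale (co x b) b))" by (simp add: co_expand)
    also have "\<dots> = lift g (emb x)"
      by (simp add: g.sum g.scale emb_sum emb_scale lift_def) (simp add: emb_def)
    finally show ?thesis by simp
  qed
  define brF where "brF u v = (\<Sum>a\<in>Basis. sc (u a) (lift (br a) v))" for u v
  have brF_right: "Vector_Spaces.linear sc sc (brF u)" for u
  proof -
    interpret l: Vector_Spaces.linear sc sc "lift g" for g by (rule lift_linear)
    show ?thesis
      by unfold_locales
        (simp_all add: brF_def l.add l.scale F.scale_right_distrib sum.distrib F.scale_sum_right mult.commute)
  qed
  have brF_left: "Vector_Spaces.linear sc sc (\<lambda>u. brF u v)" for v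
    by unfold_locales
      (simp_all add: brF_def sc_apply F.scale_left_distrib sum.distrib F.scale_sum_right)
  \<comment> \<open>A bracket with an embedded vector is the lift of a K-linear map. This is the
    form in which the derivation identity descends.\<close>
  have brF_emb_right: "brF u (emb y) = lift (\<lambda>x. br x y) u" for u y
    by (simp add: brF_def lift_emb[OF br_right] lift_def[of "\<lambda>x. br x y"])
  have brF_emb_left: "brF (emb x) v = lift (br x) v" for x v
  proof -
    have "emb (br x b) = (\<Sum>a\<in>Basis. sc (emb x a) (emb (br a b)))" for b
      using lift_emb[OF br_left, of b x] by (simp add: lift_def)
    then show ?thesis
      unfolding brF_def lift_def
      by (simp add: F.scale_sum_right mult.commute) (rule sum.swap)
  qed
  have brF_U: "brF u v \<in> U" for u v
    unfolding brF_def by (intro F.subspace_sum U F.subspace_scale lift_U)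
  interpret M: Vector_Spaces.linear sc sc "lift D" by (rule lift_linear)
  interpret brF_left: Vector_Spaces.linear sc sc "\<lambda>u. brF u v" for v by (rule brF_left)
  \<comment> \<open>The identity is first obtained for an embedded vector on the left by expanding
    the right argument, and is then extended linearly in the left argument.\<close>
  have derF: "lift D (brF u v) = brF (lift D u) v + brF u (lift D v)" if "u \<in> U" "v \<in> U" for u v
  proof -
    have *: "lift D (lift (br a) v) = lift (br (D a)) v + lift (br a) (lift D v)" for a
    proof -
      interpret l: Vector_Spaces.linear sc sc "lift g" for g by (rule lift_linear)
      have "lift D (lift (br a) v) = (\<Sum>b\<in>Basis. sc (v b) (emb (D (br a b))))"
        unfolding lift_def[of "br a"] by (simp add: M.sum M.scale lift_emb[OF D])
      also have "\<dots> = lift (br (D a)) v + (\<Sum>b\<in>Basis. sc (v b) (emb (br a (D b))))"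
        by (simp add: der emb_add F.scale_right_distrib sum.distrib lift_def[of "br (D a)"])
      also have "(\<Sum>b\<in>Basis. sc (v b) (emb (br a (D b)))) = lift (br a) (lift D v)"
        unfolding lift_def[of D] by (simp add: l.sum l.scale lift_emb[OF br_right])
      finally show ?thesis .
    qed
    have "lift D (brF u v) = (\<Sum>a\<in>Basis. sc (u a) (lift (br (D a)) v)) + brF u (lift D v)"
      by (simp add: brF_def M.sum M.scale * F.scale_right_distrib sum.distrib)
    also have "(\<Sum>a\<in>Basis. sc (u a) (lift (br (D a)) v)) = brF (lift D u) v"
      unfolding lift_def[of D] by (simp add: brF_left.sum brF_left.scale brF_emb_left)
    finally show ?thesis .
  qed
  have lift_pow_emb: "(lift D ^^ k) (emb x) = emb ((D ^^ k) x)" for k x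
    by (induction k) (simp_all add: lift_emb[OF D])

  have finE: "finite (emb ` Basis)" using finite_Basis by simp
  have lift_image_U: "lift D ` U \<subseteq> U" using lift_U by blast
  obtain n w l Q where wb: "weight_basis sc (lift D) U brF n w l Q"
    using F.exists_weight_basis[OF lift_linear[of D] U U_span finE lift_image_U brF_left brF_right brF_U derF]
    by blast
  interpret W: weight_basis sc "lift D" U brF n w l Q by (rule wb)
  have "\<exists>i<n. l i \<noteq> 0"
  proof (rule ccontr)
    assume "\<not> (\<exists>i<n. l i \<noteq> 0)"
    then have "(lift D ^^ n) (emb x) = 0" for x using W.weights_zero embU by blast
    then have "(D ^^ n) x = 0" for x by (simp add: lift_pow_emb emb_0)
    then show False using not_nilpotent by blast
  qed
  then obtain i0 where i0: "i0 < n" "l i0 \<noteq> 0" by blast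
  obtain f0 :: "'k alg_closure \<Rightarrow> rat" where f0_add: "\<And>y z. f0 (y + z) = f0 y + f0 z"
    and f0_scale: "\<And>q y. f0 (of_rat q * y) = q * f0 y" and f0_i0: "f0 (l i0) = 1"
    using exists_rational_functional[OF i0(2)] by blast
  have f0_0: "f0 0 = 0" using f0_scale[of 0 0] by simp
  have f0_sum: "f0 (\<Sum>i\<in>A. g i) = (\<Sum>i\<in>A. f0 (g i))" for g and A :: "nat set"
    by (induction A rule: infinite_finite_induct) (simp_all add: f0_0 f0_add)
  define f :: "'k alg_closure \<Rightarrow> 'k alg_closure" where "f y = of_rat (f0 y)" for y
  have f_add: "f (y + z) = f y + f z" for y z
    by (simp add: f_def f0_add of_rat_add)
  \<comment> \<open>\<open>t\<close> will be the trace of \<open>lift D\<close> composed with the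
    weight map. Applying \<open>f0\<close> turns it into the sum of the squares of the rationals
    \<open>f0 (l i)\<close>, one of which is 1, so \<open>t\<close> cannot vanish and
    \<open>h\<close> can be normalized at it.\<close>
  define t where "t = (\<Sum>i<n. f (l i) * l i)"
  have "t \<noteq> 0"
  proof
    assume "t = 0"
    then have "(\<Sum>i<n. f0 (l i) * f0 (l i)) = 0"
      using f0_sum[of "\<lambda>i. f (l i) * l i" "{..<n}"] by (simp add: t_def f_def f0_scale f0_0)
    then have "f0 (l i0) * f0 (l i0) = 0"
      using i0 by (subst (asm) sum_nonneg_eq_0_iff) auto
    then show False by (simp add: f0_i0)
  qed
  then obtain h :: "'k alg_closure \<Rightarrow> 'k" where h_add: "\<And>y z. h (y + z) = h y + h z"
    and h_scale: "\<And>c y. h (to_ac c * y) = c * h y" and h_t: "h t = 1"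
    using exists_descent_functional by blast
  have h_0: "h 0 = 0" using h_scale[of 0 0] by simp
  have h_sum: "h (\<Sum>i\<in>A. g i) = (\<Sum>i\<in>A. h (g i))" for g and A :: "'v set"
    by (induction A rule: infinite_finite_induct) (simp_all add: h_0 h_add)
  define desc where "desc u = (\<Sum>b\<in>Basis. scale (h (u b)) b)" for u
  have desc_add: "desc (u + v) = desc u + desc v" for u v
    by (simp add: desc_def h_add scale_left_distrib sum.distrib)
  have desc_scale: "desc (sc (to_ac c) u) = scale c (desc u)" for c u
    by (simp add: desc_def sc_def h_scale scale_sum_right)
  have desc_0: "desc 0 = 0"
    by (simp add: desc_def h_0)
  have desc_sum: "desc (\<Sum>i\<in>A. g i) = (\<Sum>i\<in>A. desc (g i))" for g and A :: "'v set"
    by (induction A rule: infinite_finite_induct)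
      (simp_all only: sum.infinite sum.empty sum.insert not_False_eq_True desc_add desc_0)
  have desc_emb: "desc (sc c (emb x)) = scale (h c) x" for c x
  proof -
    have "desc (sc c (emb x)) = (\<Sum>b\<in>Basis. scale (h c) (scale (co x b) b))"
      by (simp add: desc_def sc_def emb_def mult.commute[of c] h_scale mult.commute[of "h c"])
    then show ?thesis by (simp only: scale_sum_right[symmetric] co_expand)
  qed
  \<comment> \<open>\<open>lift g\<close> has a matrix over K, and its entries pass through the
    K-linear \<open>h\<close>.\<close>
  have desc_lift: "desc (lift g u) = g (desc u)" if "Vector_Spaces.linear scale scale g" for g u
  proof -
    interpret g: Vector_Spaces.linear scale scale g by (rule that)
    show ?thesis unfolding lift_def desc_sum desc_emb by (simp add: desc_def g.sum g.scale)
  qed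

  define E where "E x = desc (W.weight_map f (emb x))" for x
  show ?thesis
  proof (rule that[of E])
    show "Vector_Spaces.linear scale scale E"
      by unfold_locales
        (simp_all add: E_def emb_add W.weight_map_add embU desc_add emb_scale W.weight_map_scale desc_scale)
    show "E (br x y) = br (E x) y + br x (E y)" for x y
    proof -
      have "E (br x y) = desc (W.weight_map f (brF (emb x) (emb y)))"
        by (simp add: E_def brF_emb_right lift_emb[OF br_left])
      \<comment> \<open>Each summand of the derivation rule still contains one embedded vector,
        hence is a lift, and \<open>desc_lift\<close> applies to it.\<close>
      also have "\<dots> = desc (lift (\<lambda>x. br x y) (W.weight_map f (emb x))) + desc (lift (br x) (W.weight_map f (emb y)))"
        by (subst W.weight_map_derivation[OF f_add embU embU])
          (simp only: desc_add brF_emb_left brF_emb_right)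
      finally show ?thesis by (simp add: desc_lift[OF br_left] desc_lift[OF br_right] E_def)
    qed
    show "range E \<subseteq> range (D ^^ k)" for k
    proof
      fix y assume "y \<in> range E"
      then obtain x where y: "y = desc (W.weight_map f (emb x))" by (auto simp: E_def)
      have "W.weight_map f (emb x) \<in> (lift D ^^ k) ` U"
        by (intro W.weight_map_range lift_linear) (simp add: f_def f0_0)
      then obtain u where "W.weight_map f (emb x) = (lift D ^^ k) u" by blast
      moreover have "desc ((lift D ^^ k) u) = (D ^^ k) (desc u)"
        by (induction k) (simp_all add: desc_lift[OF D])
      ultimately show "y \<in> range (D ^^ k)" using y by auto
    qed
    have "trace (\<lambda>x. D (E x)) = h (\<Sum>b\<in>Basis. lift D (W.weight_map f (emb b)) b)"
    proof -
      have "co (desc u) b = h (u b)" if "b \<in> Basis" for u b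
      proof -
        have "co (desc u) b = (\<Sum>a\<in>Basis. if a = b then h (u b) else 0)"
          unfolding desc_def co_sum by (intro sum.cong) (auto simp: co_scale co_Basis)
        then show ?thesis using that finite_Basis by simp
      qed
      then show ?thesis
        by (simp add: trace_def co_def[symmetric] E_def desc_lift[OF D, symmetric] h_sum)
    qed
    \<comment> \<open>Change of basis for the trace: expand the weight map in the \<open>w i\<close>
      and exchange the sums. The inner sum over \<open>Basis\<close> reassembles
      \<open>lift D (w i)\<close>, whose i-th coordinate is the weight \<open>l i\<close>.\<close>
    also have "(\<Sum>b\<in>Basis. lift D (W.weight_map f (emb b)) b) = t"
    proof -
      have "(\<Sum>b\<in>Basis. lift D (W.weight_map f (emb b)) b)
        = (\<Sum>b\<in>Basis. \<Sum>i<n. f (l i) * (lift D (w i) b * Q i (emb b)))"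
        by (simp add: W.weight_map_def M.sum M.scale sum_fun_apply) (simp add: sc_def algebra_simps)
      also have "\<dots> = (\<Sum>i<n. f (l i) * (\<Sum>b\<in>Basis. Q i (sc (lift D (w i) b) (emb b))))"
        by (subst sum.swap) (simp add: sum_distrib_left W.coord_scale embU)
      also have "\<dots> = (\<Sum>i<n. f (l i) * Q i (lift D (w i)))"
        by (subst W.coord_sum[symmetric], intro F.subspace_scale U embU) (simp add: expandU[OF lift_U, symmetric])
      finally show ?thesis by (simp add: W.coord_diag t_def)
    qed
    finally show "trace (\<lambda>x. D (E x)) \<noteq> 0" by (simp add: h_t)
  qed
qed

end

section \<open>The trace of an endomorphism\<close>

context finite_dimensional_vector_space
begin

lemma trace_add: "trace (\<lambda>x. f x + g x) = trace f + trace g"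
  by (simp add: trace_def representation_add[OF independent_Basis] span_Basis sum.distrib)

lemma trace_scale: "trace (\<lambda>x. scale c (f x)) = c * trace f"
  by (simp add: trace_def representation_scale[OF independent_Basis] span_Basis sum_distrib_left)

lemma trace_0: "trace (\<lambda>x. 0) = 0"
  by (simp add: trace_def representation_zero)

lemma trace_diff: "trace (\<lambda>x. f x - g x) = trace f - trace g"
  by (simp add: trace_def representation_diff[OF independent_Basis] span_Basis sum_subtractf)

lemma trace_commute:
  assumes "Vector_Spaces.linear scale scale f" "Vector_Spaces.linear scale scale g"
  shows "trace (\<lambda>x. f (g x)) = trace (\<lambda>x. g (f x))"
proof -
  have expand: "trace (\<lambda>x. f (g x))
      = (\<Sum>b\<in>Basis. \<Sum>a\<in>Basis. representation Basis (g b) a * representation Basis (f a) b)"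
    if "Vector_Spaces.linear scale scale f" for f g :: "'b \<Rightarrow> 'b"
    unfolding trace_def
  proof (intro sum.cong refl)
    interpret f: Vector_Spaces.linear scale scale f by (rule that)
    fix b
    have "f (g b) = f (\<Sum>a\<in>Basis. scale (representation Basis (g b) a) a)"
      by (subst sum_representation_eq) (simp_all add: independent_Basis span_Basis finite_Basis)
    also have "\<dots> = (\<Sum>a\<in>Basis. scale (representation Basis (g b) a) (f a))"
      by (simp add: f.sum f.scale)
    finally show "representation Basis (f (g b)) b
        = (\<Sum>a\<in>Basis. representation Basis (g b) a * representation Basis (f a) b)"
      by (simp add: representation_sum[OF independent_Basis] representation_scale[OF independent_Basis] span_Basis)
  qed
  show ?thesis
    unfolding expand[OF assms(1)] expand[OF assms(2)] by (subst sum.swap) (simp add: mult.commute)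
qed

end

section \<open>Lie algebras\<close>

context lie_algebra
begin

sublocale left: Vector_Spaces.linear scale scale "\<lambda>x. bracket x y" for y
  by (rule bracket_linear_left)

sublocale right: Vector_Spaces.linear scale scale "bracket x" for x
  by (rule bracket_linear_right)

lemma bracket_skew: "\<lblot>x, y\<rblot> = - \<lblot>y, x\<rblot>"
proof -
  have "\<lblot>x + y, x + y\<rblot> = \<lblot>x, x\<rblot> + \<lblot>y, y\<rblot> + (\<lblot>x, y\<rblot> + \<lblot>y, x\<rblot>)"
    by (simp add: left.add right.add add.assoc add.commute add.left_commute)
  then have "\<lblot>x, y\<rblot> + \<lblot>y, x\<rblot> = 0" by (simp add: bracket_self)
  then show ?thesis by (simp add: eq_neg_iff_add_eq_0)
qed

lemma bracket_derivation: "\<lblot>x, \<lblot>y, z\<rblot>\<rblot> = \<lblot>\<lblot>x, y\<rblot>, z\<rblot> + \<lblot>y, \<lblot>x, z\<rblot>\<rblot>"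
proof -
  have "\<lblot>y, \<lblot>z, x\<rblot>\<rblot> = - \<lblot>y, \<lblot>x, z\<rblot>\<rblot>"
    by (subst bracket_skew[of z x]) (rule right.neg)
  moreover have "\<lblot>z, \<lblot>x, y\<rblot>\<rblot> = - \<lblot>\<lblot>x, y\<rblot>, z\<rblot>" by (rule bracket_skew)
  ultimately have "\<lblot>x, \<lblot>y, z\<rblot>\<rblot> + - \<lblot>y, \<lblot>x, z\<rblot>\<rblot> + - \<lblot>\<lblot>x, y\<rblot>, z\<rblot> = 0"
    using jacobi[of x y z] by argo
  then show ?thesis by (simp add: algebra_simps)
qed

lemma bracket_bracket_left: "\<lblot>\<lblot>x, y\<rblot>, z\<rblot> = \<lblot>x, \<lblot>y, z\<rblot>\<rblot> - \<lblot>y, \<lblot>x, z\<rblot>\<rblot>"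
  by (simp add: bracket_derivation[of x y z])

lemma subspace_bracket_span: "subspace (bracket_span A B)"
  by (simp add: bracket_span_def)

lemma bracket_in_bracket_span: "a \<in> A \<Longrightarrow> b \<in> B \<Longrightarrow> \<lblot>a, b\<rblot> \<in> bracket_span A B"
  unfolding bracket_span_def by (intro span_base) auto

lemma bracket_span_minimal:
  "(\<And>a b. a \<in> A \<Longrightarrow> b \<in> B \<Longrightarrow> \<lblot>a, b\<rblot> \<in> S) \<Longrightarrow> subspace S \<Longrightarrow> bracket_span A B \<subseteq> S"
  unfolding bracket_span_def by (intro span_minimal) auto

lemma bracket_span_mono: "A \<subseteq> A' \<Longrightarrow> B \<subseteq> B' \<Longrightarrow> bracket_span A B \<subseteq> bracket_span A' B'"
  unfolding bracket_span_def by (intro span_mono) auto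

lemma derived_series_mono: "A \<subseteq> B \<Longrightarrow> derived_series A k \<subseteq> derived_series B k"
  by (induction k) (simp_all add: bracket_span_mono)

lemma derived_series_add: "derived_series L (k + m) = derived_series (derived_series L k) m"
  by (induction m) simp_all

text \<open>From index k on, the derived series of \<open>L\<close> lies inside that of
  \<open>H\<close>. Since \<open>solvable\<close> asks for equality with {0}, the terms must also
  contain 0; at index 0 this comes from \<open>subspace L\<close>.\<close>

lemma solvable_if_derived_subset:
  assumes "subspace L" "derived_series L k \<subseteq> H" "solvable H"
  shows "solvable L"
proof -
  obtain m where "derived_series H m = {0}" using assms(3) by (auto simp: solvable_def)
  then have "derived_series L (k + m) \<subseteq> {0}"
    using derived_series_mono[OF assms(2), of m] by (simp add: derived_series_add)
  moreover have "subspace (derived_series L j)" for j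
    using assms(1) by (cases j) (simp_all add: subspace_bracket_span)
  ultimately show ?thesis
    using subspace_0 unfolding solvable_def by blast
qed

lemma subspace_lower_central: "subspace (lower_central UNIV m)"
  by (cases m; cases "m - 1") (simp_all add: subspace_bracket_span)

lemma bracket_lower_central: "m > 0 \<Longrightarrow> y \<in> lower_central UNIV m \<Longrightarrow> \<lblot>x, y\<rblot> \<in> lower_central UNIV (Suc m)"
  by (cases m) (simp_all add: bracket_in_bracket_span)

lemma lower_central_Suc_subset: "lower_central UNIV (Suc m) \<subseteq> lower_central UNIV m"
proof (induction m)
  case (Suc m)
  then show ?case
    by (cases m) (simp_all add: bracket_span_mono)
qed simp

text \<open>The shift by one arises because the derived series starts at index 0 and the lower
  central series at index 1.\<close>

lemma derived_series_subset_lower_central: "derived_series UNIV m \<subseteq> lower_central UNIV (Suc m)"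
  by (induction m) (simp_all add: bracket_span_mono)

lemma lie_subalgebra_lower_central: "lie_subalgebra (lower_central UNIV m)"
  unfolding lie_subalgebra_def
proof (intro conjI ballI)
  fix x y assume "x \<in> lower_central UNIV m" "y \<in> lower_central UNIV m"
  then show "\<lblot>x, y\<rblot> \<in> lower_central UNIV m"
    using bracket_lower_central[of m y x] lower_central_Suc_subset[of m] by (cases m) auto
qed (rule subspace_lower_central)

lemma ad_power_in_lower_central: "(bracket x ^^ k) y \<in> lower_central UNIV (Suc k)"
  by (induction k) (simp_all add: bracket_in_bracket_span)

end

section \<open>Engel's theorem\<close>

locale fd_lie_algebra = lie_algebra scale bracket + finite_dimensional_vector_space scale Basis
  for scale :: "'k::field \<Rightarrow> 'v::ab_group_add \<Rightarrow> 'v" and bracket (\<open>\<lblot>_,/ _\<rblot>\<close>) and Basis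
begin

text \<open>Let M be a proper subalgebra of greatest dimension and z outside M normalize it. Then M
  + Kz is a larger subalgebra, hence all of H, and M is an ideal of codimension one. Both inductions
  for Engel's theorem use this.\<close>

lemma proper_ideal_of_normalizers:
  assumes H: "lie_subalgebra H" "H \<noteq> {0}"
    and grow: "\<And>M. lie_subalgebra M \<Longrightarrow> M \<subset> H \<Longrightarrow> \<exists>z\<in>H - M. \<forall>h\<in>M. \<lblot>h, z\<rblot> \<in> M"
  obtains M z where "lie_subalgebra M" "M \<subset> H" "z \<in> H" "\<And>h. h \<in> M \<Longrightarrow> \<lblot>h, z\<rblot> \<in> M"
    "\<And>x. x \<in> H \<Longrightarrow> \<exists>c. x - scale c z \<in> M"
proof -
  have sH: "subspace H" using H by (simp add: lie_subalgebra_def)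
  have "lie_subalgebra {0} \<and> {0} \<subset> H"
    using H subspace_0[OF sH] by (auto simp: lie_subalgebra_def)
  then obtain M where M: "lie_subalgebra M" "M \<subset> H"
    and max: "\<And>M'. lie_subalgebra M' \<Longrightarrow> M' \<subset> H \<Longrightarrow> dim M' \<le> dim M"
    using ex_has_greatest_nat[of "\<lambda>M. lie_subalgebra M \<and> M \<subset> H" "{0}" dim "Suc dimension"]
    by (auto simp: less_Suc_eq_le dim_subset_UNIV)
  have sM: "subspace M" using M by (simp add: lie_subalgebra_def)
  obtain z where z: "z \<in> H" "z \<notin> M" "\<And>h. h \<in> M \<Longrightarrow> \<lblot>h, z\<rblot> \<in> M"
    using grow[OF M] by blast
  let ?N = "span (insert z M)"
  have N_iff: "x \<in> ?N \<longleftrightarrow> (\<exists>c. x - scale c z \<in> M)" for x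
    using sM by (simp add: span_breakdown_eq span_eq_iff[THEN iffD2])
  have N_sub: "?N \<subseteq> H" using M z sH by (intro span_minimal) auto
  have "lie_subalgebra ?N"
    unfolding lie_subalgebra_def
  proof (intro conjI ballI subspace_span)
    fix x y assume "x \<in> ?N" "y \<in> ?N"
    then obtain c d where "x - scale c z \<in> M" "y - scale d z \<in> M" by (auto simp: N_iff)
    then obtain h k where h: "h \<in> M" "x = h + scale c z" and k: "k \<in> M" "y = k + scale d z"
      by (metis diff_add_cancel)
    \<comment> \<open>Because [z, z] = 0, the bracket falls into M itself.\<close>
    have "\<lblot>x, y\<rblot> = \<lblot>h, k\<rblot> + scale d \<lblot>h, z\<rblot> - scale c \<lblot>k, z\<rblot>"
      using bracket_skew[of z k]
      by (simp add: h k left.add right.add left.scale right.scale bracket_self)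
    also have "\<dots> \<in> M"
      using h k z M by (intro subspace_diff subspace_add subspace_scale sM) (auto simp: lie_subalgebra_def)
    finally show "\<lblot>x, y\<rblot> \<in> ?N" using span_superset[of "insert z M"] by auto
  qed
  moreover have "dim M < dim ?N"
  proof -
    have "span M \<subset> span ?N"
      using z sM span_superset[of "insert z M"] span_mono[of M "insert z M"]
      by (auto simp: span_eq_iff[THEN iffD2])
    then show ?thesis using dim_psubset by blast
  qed
  ultimately have "?N = H" using max[of ?N] N_sub by fastforce
  then show ?thesis using that[OF M z(1,3)] N_iff by blast
qed

text \<open>This is Engel's theorem for the action of H on V/W, phrased without quotients: some
  nonzero class is killed by all of H. The relative form lets the induction also supply the
  normalizing element z.\<close>

lemma engel_vector:
  assumes "lie_subalgebra H" "\<And>x. x \<in> H \<Longrightarrow> \<exists>k. \<forall>y. (bracket x ^^ k) y = 0"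
    and "subspace V" "subspace W" "W \<subset> V"
    and "\<And>h v. h \<in> H \<Longrightarrow> v \<in> V \<Longrightarrow> \<lblot>h, v\<rblot> \<in> V"
    and "\<And>h v. h \<in> H \<Longrightarrow> v \<in> W \<Longrightarrow> \<lblot>h, v\<rblot> \<in> W"
  shows "\<exists>v\<in>V - W. \<forall>h\<in>H. \<lblot>h, v\<rblot> \<in> W"
  using assms
proof (induction "dim H" arbitrary: H V W rule: less_induct)
  case less
  show ?case
  proof (cases "H = {0}")
    case True
    then show ?thesis using less.prems subspace_0 by (auto simp: left.zero)
  next
    case False
    have sH: "subspace H" using less.prems by (simp add: lie_subalgebra_def)
    have smaller: "dim M < dim H" if "lie_subalgebra M" "M \<subset> H" for M
      using that sH by (intro dim_psubset) (simp add: lie_subalgebra_def span_eq_iff[THEN iffD2])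
    obtain M z where M: "lie_subalgebra M" "M \<subset> H" and z: "z \<in> H"
      and Mz: "\<And>h. h \<in> M \<Longrightarrow> \<lblot>h, z\<rblot> \<in> M"
      and H_decomp: "\<And>x. x \<in> H \<Longrightarrow> \<exists>c. x - scale c z \<in> M"
    proof (rule proper_ideal_of_normalizers[OF less.prems(1) False])
      fix M assume M: "lie_subalgebra M" "M \<subset> H"
      \<comment> \<open>The induction hypothesis is applied to M acting on H modulo M.\<close>
      show "\<exists>z\<in>H - M. \<forall>h\<in>M. \<lblot>h, z\<rblot> \<in> M"
        using less.prems(1,2) M by (intro less.hyps[OF smaller[OF M]]) (auto simp: lie_subalgebra_def)
    qed blast
    have "\<exists>v\<in>V - W. \<forall>h\<in>M. \<lblot>h, v\<rblot> \<in> W"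
      using less.prems M by (intro less.hyps[OF smaller[OF M]]) auto
    then obtain v where v: "v \<in> V" "v \<notin> W" "\<And>h. h \<in> M \<Longrightarrow> \<lblot>h, v\<rblot> \<in> W" by blast
    \<comment> \<open>The vectors that M sends into W are stable under ad z, because [M, z] lies in
      M.\<close>
    have iter: "(bracket z ^^ k) v \<in> V \<and> (\<forall>h\<in>M. \<lblot>h, (bracket z ^^ k) v\<rblot> \<in> W)" for k
    proof (induction k)
      case (Suc k)
      let ?u = "(bracket z ^^ k) v"
      have "\<lblot>h, \<lblot>z, ?u\<rblot>\<rblot> \<in> W" if "h \<in> M" for h
      proof -
        have "\<lblot>h, \<lblot>z, ?u\<rblot>\<rblot> = \<lblot>\<lblot>h, z\<rblot>, ?u\<rblot> + \<lblot>z, \<lblot>h, ?u\<rblot>\<rblot>" by (rule bracket_derivation)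
        also have "\<dots> \<in> W"
          using Suc Mz that z less.prems(7) by (intro subspace_add[OF less.prems(4)]) auto
        finally show ?thesis .
      qed
      then show ?case using Suc z less.prems(6) by auto
    qed (use v in auto)
    obtain k where "(bracket z ^^ k) v = 0" using less.prems(2)[OF z] by blast
    then have "(bracket z ^^ k) v \<in> W" using subspace_0[OF less.prems(4)] by simp
    \<comment> \<open>The last iterate outside W is sent into W by z as well as by M, hence by all
      of H.\<close>
    then obtain j where j: "(bracket z ^^ j) v \<notin> W" "(bracket z ^^ Suc j) v \<in> W"
      using v(2) by (induction k) auto
    let ?u = "(bracket z ^^ j) v"
    have "\<lblot>x, ?u\<rblot> \<in> W" if x: "x \<in> H" for x
    proof -
      obtain c where c: "x - scale c z \<in> M" using H_decomp[OF x] by blast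
      have "\<lblot>x, ?u\<rblot> = \<lblot>x - scale c z, ?u\<rblot> + scale c \<lblot>z, ?u\<rblot>"
        by (simp add: left.diff left.scale)
      also have "\<dots> \<in> W"
        using iter c j(2) by (intro subspace_add subspace_scale less.prems(4)) auto
      finally show ?thesis .
    qed
    then show ?thesis using iter[of j] j(1) by blast
  qed
qed

text \<open>\<open>engel_vector\<close> for M acting on H modulo M gives an ideal M of codimension
  one. It contains [H, H] and is solvable by induction on the dimension.\<close>

lemma engel_solvable:
  assumes "lie_subalgebra H" "\<And>x. x \<in> H \<Longrightarrow> \<exists>k. \<forall>y. (bracket x ^^ k) y = 0"
  shows "solvable H"
  using assms
proof (induction "dim H" arbitrary: H rule: less_induct)
  case less
  have sH: "subspace H" using less.prems by (simp add: lie_subalgebra_def)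
  show ?case
  proof (cases "H = {0}")
    case True
    then have "derived_series H 0 = {0}" by simp
    then show ?thesis unfolding solvable_def by blast
  next
    case False
    obtain M z where M: "lie_subalgebra M" "M \<subset> H" and z: "z \<in> H"
      and Mz: "\<And>h. h \<in> M \<Longrightarrow> \<lblot>h, z\<rblot> \<in> M"
      and H_decomp: "\<And>x. x \<in> H \<Longrightarrow> \<exists>c. x - scale c z \<in> M"
    proof (rule proper_ideal_of_normalizers[OF less.prems(1) False])
      fix M assume M: "lie_subalgebra M" "M \<subset> H"
      show "\<exists>z\<in>H - M. \<forall>h\<in>M. \<lblot>h, z\<rblot> \<in> M"
        using less.prems M by (intro engel_vector) (auto simp: lie_subalgebra_def)
    qed blast
    have sM: "subspace M" using M by (simp add: lie_subalgebra_def)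
    have "dim M < dim H"
      using M sH sM by (intro dim_psubset) (simp add: span_eq_iff[THEN iffD2])
    then have "solvable M" using less M by blast
    moreover have "derived_series H 1 \<subseteq> M"
    proof -
      have "\<lblot>x, y\<rblot> \<in> M" if xy: "x \<in> H" "y \<in> H" for x y
      proof -
        obtain c d where "x - scale c z \<in> M" "y - scale d z \<in> M"
          using H_decomp[OF xy(1)] H_decomp[OF xy(2)] by blast
        then obtain h k where h: "h \<in> M" "x = h + scale c z" and k: "k \<in> M" "y = k + scale d z"
          by (metis diff_add_cancel)
        have "\<lblot>x, y\<rblot> = \<lblot>h, k\<rblot> + scale d \<lblot>h, z\<rblot> - scale c \<lblot>k, z\<rblot>"
          using bracket_skew[of z k]
          by (simp add: h k left.add right.add left.scale right.scale bracket_self)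
        also have "\<dots> \<in> M"
          using h k Mz M by (intro subspace_diff subspace_add subspace_scale sM) (auto simp: lie_subalgebra_def)
        finally show ?thesis .
      qed
      then show ?thesis by (simp add: bracket_span_minimal sM)
    qed
    ultimately show ?thesis using solvable_if_derived_subset[OF sH] by blast
  qed
qed

section \<open>Nilpotency and solvability\<close>

text \<open>For y = [b, c] with b in A, ad a commutes with ad b, so ad a ad y is the commutator of
  ad b with ad a ad c and has trace zero. Linearity covers the rest of [A, L].\<close>

lemma trace_form_orthogonal:
  assumes A: "abelian A" and a: "a \<in> A" and y: "y \<in> bracket_span A UNIV"
  shows "trace (\<lambda>u. \<lblot>a, \<lblot>y, u\<rblot>\<rblot>) = 0"
proof -
  let ?S = "{y. trace (\<lambda>u. \<lblot>a, \<lblot>y, u\<rblot>\<rblot>) = 0}"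
  have "bracket_span A UNIV \<subseteq> ?S"
  proof (rule bracket_span_minimal)
    show "subspace ?S"
      by (simp add: subspace_def left.zero left.add left.scale right.zero right.add right.scale
          trace_0 trace_add trace_scale)
  next
    fix b c assume "b \<in> A"
    then have comm: "\<lblot>a, \<lblot>b, v\<rblot>\<rblot> = \<lblot>b, \<lblot>a, v\<rblot>\<rblot>" for v
      using A a by (simp add: bracket_derivation[of a b v] abelian_def left.zero)
    have lin: "Vector_Spaces.linear scale scale (\<lambda>u. \<lblot>a, \<lblot>c, u\<rblot>\<rblot>)"
      by unfold_locales (simp_all add: right.add right.scale)
    have "trace (\<lambda>u. \<lblot>a, \<lblot>\<lblot>b, c\<rblot>, u\<rblot>\<rblot>)
        = trace (\<lambda>u. \<lblot>b, \<lblot>a, \<lblot>c, u\<rblot>\<rblot>\<rblot>) - trace (\<lambda>u. \<lblot>a, \<lblot>c, \<lblot>b, u\<rblot>\<rblot>\<rblot>)"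
      by (simp add: bracket_bracket_left right.diff comm trace_diff)
    also have "\<dots> = 0"
      using trace_commute[OF bracket_linear_right[of b] lin] by simp
    finally show "\<lblot>b, c\<rblot> \<in> ?S" by simp
  qed
  then show ?thesis using y by blast
qed

text \<open>Cyclicity turns tr (ad c ad a E) into tr (ad a E ad c), and E ad c = ad (E c) + ad c E.
  For y = [a, c] only - tr (ad a ad (E c)) remains, which vanishes since E c lies in [A, L].\<close>

lemma trace_ad_derivation:
  assumes A: "abelian A" and E: "Vector_Spaces.linear scale scale E"
    and der: "\<And>x y. E \<lblot>x, y\<rblot> = \<lblot>E x, y\<rblot> + \<lblot>x, E y\<rblot>"
    and range: "range E \<subseteq> bracket_span A UNIV" and y: "y \<in> bracket_span A UNIV"
  shows "trace (\<lambda>u. \<lblot>y, E u\<rblot>) = 0"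
proof -
  interpret E: Vector_Spaces.linear scale scale E by (rule E)
  let ?S = "{y. trace (\<lambda>u. \<lblot>y, E u\<rblot>) = 0}"
  have "bracket_span A UNIV \<subseteq> ?S"
  proof (rule bracket_span_minimal)
    show "subspace ?S"
      by (simp add: subspace_def left.zero left.add left.scale trace_0 trace_add trace_scale)
  next
    fix a c assume a: "a \<in> A"
    have lin: "Vector_Spaces.linear scale scale (\<lambda>u. \<lblot>a, E u\<rblot>)"
      by unfold_locales (simp_all add: right.add right.scale E.add E.scale)
    have "trace (\<lambda>u. \<lblot>\<lblot>a, c\<rblot>, E u\<rblot>) = trace (\<lambda>u. \<lblot>a, \<lblot>c, E u\<rblot>\<rblot>) - trace (\<lambda>u. \<lblot>c, \<lblot>a, E u\<rblot>\<rblot>)"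
      by (simp add: bracket_bracket_left trace_diff)
    also have "trace (\<lambda>u. \<lblot>c, \<lblot>a, E u\<rblot>\<rblot>) = trace (\<lambda>u. \<lblot>a, E \<lblot>c, u\<rblot>\<rblot>)"
      by (rule trace_commute[OF bracket_linear_right lin])
    also have "\<dots> = trace (\<lambda>u. \<lblot>a, \<lblot>E c, u\<rblot>\<rblot>) + trace (\<lambda>u. \<lblot>a, \<lblot>c, E u\<rblot>\<rblot>)"
      by (simp add: der right.add trace_add)
    also have "trace (\<lambda>u. \<lblot>a, \<lblot>E c, u\<rblot>\<rblot>) = 0"
      using range by (intro trace_form_orthogonal[OF A a]) auto
    finally show "\<lblot>a, c\<rblot> \<in> ?S" by simp
  qed
  then show ?thesis using y by blast
qed

end

locale fd_lie_algebra_char_0 = fd_lie_algebra scale bracket Basis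
  for scale :: "'k::field_char_0 \<Rightarrow> 'v::ab_group_add \<Rightarrow> 'v" and bracket (\<open>\<lblot>_,/ _\<rblot>\<close>) and Basis
begin

sublocale fd_space_char_0 scale Basis ..

text \<open>A replica E of a non-nilpotent ad x has its range in that of (ad x)^n, which lies in
  L^(n+1), hence in L^n and in [A, L]. As x lies there too, \<open>trace_ad_derivation\<close>
  contradicts the nonzero trace.\<close>

lemma ad_nilpotent:
  assumes A: "abelian A" and n: "lower_central UNIV n \<subseteq> bracket_span A UNIV"
    and x: "x \<in> lower_central UNIV n"
  shows "\<exists>k. \<forall>y. (bracket x ^^ k) y = 0"
proof (rule ccontr)
  assume "\<not> ?thesis"
  then have not_nilpotent: "\<exists>y. (bracket x ^^ k) y \<noteq> 0" for k by blast
  show False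
  proof (rule exists_replica[where D = "bracket x" and br = bracket,
        OF bracket_linear_right bracket_linear_left bracket_linear_right bracket_derivation not_nilpotent])
    fix E
    assume E: "Vector_Spaces.linear scale scale E" "\<And>y z. E \<lblot>y, z\<rblot> = \<lblot>E y, z\<rblot> + \<lblot>y, E z\<rblot>"
      and range: "\<And>k. range E \<subseteq> range (bracket x ^^ k)"
      and trace: "trace (\<lambda>u. \<lblot>x, E u\<rblot>) \<noteq> 0"
    have "range (bracket x ^^ n) \<subseteq> lower_central UNIV n"
      using ad_power_in_lower_central lower_central_Suc_subset by blast
    then have "range E \<subseteq> bracket_span A UNIV" using range[of n] n by blast
    then have "trace (\<lambda>u. \<lblot>x, E u\<rblot>) = 0"
      using n x by (intro trace_ad_derivation[OF A E]) auto
    then show False using trace by contradiction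
  qed
qed

lemma solvable_UNIV:
  assumes "abelian A" "lower_central UNIV n \<subseteq> bracket_span A UNIV"
  shows "solvable UNIV"
proof (rule solvable_if_derived_subset)
  show "solvable (lower_central UNIV n)"
    using ad_nilpotent[OF assms] lie_subalgebra_lower_central by (intro engel_solvable)
  show "derived_series UNIV n \<subseteq> lower_central UNIV n"
    using derived_series_subset_lower_central lower_central_Suc_subset by blast
qed (rule subspace_UNIV)

end

theorem theorem1:
  fixes scale :: "'k::field_char_0 \<Rightarrow> 'v::ab_group_add \<Rightarrow> 'v"
    and bracket :: "'v \<Rightarrow> 'v \<Rightarrow> 'v"
  assumes "lie_algebra scale bracket"
    and "\<exists>Basis. finite_dimensional_vector_space scale Basis"
    and "\<exists>A n. lie_algebra.lie_subalgebra scale bracket A \<and> lie_algebra.abelian bracket A \<and> n > 1 \<and>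
           lie_algebra.lower_central scale bracket UNIV n
             \<subseteq> lie_algebra.bracket_span scale bracket A UNIV"
  shows "lie_algebra.solvable scale bracket UNIV"
proof -
  obtain Basis where "finite_dimensional_vector_space scale Basis" using assms(2) by blast
  then interpret fd_lie_algebra_char_0 scale bracket Basis
    using assms(1) by (simp add: fd_lie_algebra_char_0_def fd_lie_algebra_def)
  show ?thesis using assms(3) solvable_UNIV by blast
qed

end
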